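(* Let $k,l$ be integers with either (i) $k\ge 4$ and $l\ge 3$, or (ii) $k=3$ and $l\ge 2074$. Then the graph $\overline{T_{n,l-1}}$ is not optimal for the $(k,l)$-problem: there is $N$ such that for every $n\ge N$ there exists an $n$-vertex graph $G$ with $\alpha(G)<l$ and $t_k(G)<t_k(\overline{T_{n,l-1}})$; that is, $f(n,k,l)<t_k(\overline{T_{n,l-1}})$.
   Context: For a graph $G$, $\alpha(G)$ is its independence number and $t_k(G)$ is the number of $k$-cliques in $G$. $f(n,k,l)$ is the minimum of $t_k(G)$ over $n$-vertex graphs $G$ with $\alpha(G)<l$ (the "$(k,l)$-problem"). $\overline{T_{n,l-1}}$ denotes the complement of the Turán graph, i.e. the disjoint union of $l-1$ cliques on $n$ vertices in total whose sizes are as equal as possible; it has $\alpha=l-1$. *)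

theory Defs
  imports Complex_Main "HOL-Library.Ramsey"
begin

text \<open>
  A finite simple graph is a finite vertex set together with a set of two-element subsets of it;
  cliques and independent sets are the predicates of the Ramsey theory of the library.
\<close>

definition fin_sgraph :: "'a set \<Rightarrow> 'a set set \<Rightarrow> bool" where
  "fin_sgraph V E \<longleftrightarrow> finite V \<and> E \<subseteq> [V]\<^bsup>2\<^esup>"

definition independence_number :: "'a set \<Rightarrow> 'a set set \<Rightarrow> nat" where
  "independence_number V E = Max {card S | S. S \<subseteq> V \<and> indep S E}"

definition num_cliques :: "nat \<Rightarrow> 'a set \<Rightarrow> 'a set set \<Rightarrow> nat" where
  "num_cliques k V E = card {S. S \<subseteq> V \<and> card S = k \<and> clique S E}"

definition admissible :: "nat \<Rightarrow> nat \<Rightarrow> nat set \<Rightarrow> nat set set \<Rightarrow> bool" where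
  "admissible n l V E \<longleftrightarrow> fin_sgraph V E \<and> card V = n \<and> independence_number V E < l"

text \<open>
  Vertices are natural numbers, which covers every finite graph up to isomorphism. The infimum of
  a nonempty set of natural numbers is its minimum; see \<open>min_cliques_attained\<close> below.
\<close>

definition min_cliques :: "nat \<Rightarrow> nat \<Rightarrow> nat \<Rightarrow> nat" where
  "min_cliques n k l = Inf {num_cliques k V E | V E. admissible n l V E}"

definition complement_edges :: "'a set \<Rightarrow> 'a set set \<Rightarrow> 'a set set" where
  "complement_edges V E = [V]\<^bsup>2\<^esup> - E"

text \<open>
  The Turan graph with \<open>r\<close> parts on the vertices \<open>0, \<dots>, n - 1\<close>: the parts are the residue classes
  modulo \<open>r\<close>, whose sizes differ by at most one.
\<close>

definition turan_edges :: "nat \<Rightarrow> nat \<Rightarrow> nat set set" where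
  "turan_edges n r = {{i, j} | i j. i < n \<and> j < n \<and> i mod r \<noteq> j mod r}"

definition co_turan_edges :: "nat \<Rightarrow> nat \<Rightarrow> nat set set" where
  "co_turan_edges n r = complement_edges {..<n} (turan_edges n r)"


lemma turan_part_card:
  fixes n r c :: nat
  assumes "c < r"
  shows "card {i. i < n \<and> i mod r = c} = (if c < n mod r then n div r + 1 else n div r)"
proof -
  define m where "m = (if c < n mod r then n div r + 1 else n div r)"
  have nn: "n = n div r * r + n mod r" by simp
  have lt: "n mod r < r" using assms by simp
  have "q * r + c < n \<longleftrightarrow> q < m" for q
  proof
    assume q: "q * r + c < n"
    show "q < m"
    proof (rule ccontr)
      assume "\<not> q < m"
      then have "m * r \<le> q * r" by simp
      then have le: "m * r + c < n" using q by linarith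
      show False
      proof (cases "c < n mod r")
        case True
        then have "m * r = n div r * r + r" by (simp add: m_def)
        then show False using le nn lt by linarith
      next
        case False
        then have "m * r = n div r * r" by (simp add: m_def)
        then show False using le nn False by linarith
      qed
    qed
  next
    assume "q < m"
    then have "q < n div r \<or> (q = n div r \<and> c < n mod r)"
      by (auto simp: m_def split: if_splits)
    then show "q * r + c < n"
    proof
      assume "q < n div r"
      then have "Suc q * r \<le> n div r * r" by (intro mult_le_mono1) simp
      then show ?thesis using nn assms mult_Suc[of q r] by linarith
    next
      assume q: "q = n div r \<and> c < n mod r"
      then have "q * r = n div r * r" by simp
      then show ?thesis using nn q by linarith
    qed
  qed
  note iff = this
  have "{i. i < n \<and> i mod r = c} = (\<lambda>q. q * r + c) ` {..<m}"
  proof (intro equalityI subsetI)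
    fix i assume "i \<in> {i. i < n \<and> i mod r = c}"
    then have i: "i < n" "i = (i div r) * r + c" by auto
    then have "(i div r) * r + c < n" by simp
    then have "i div r < m" using iff by blast
    then show "i \<in> (\<lambda>q. q * r + c) ` {..<m}" using i(2) by blast
  next
    fix i assume "i \<in> (\<lambda>q. q * r + c) ` {..<m}"
    then show "i \<in> {i. i < n \<and> i mod r = c}" using iff assms by fastforce
  qed
  moreover have "inj_on (\<lambda>q. q * r + c) {..<m}" using assms by (auto simp: inj_on_def)
  ultimately show ?thesis by (simp add: card_image m_def)
qed

lemma doubleton_in_co_turan_edges:
  "{i, j} \<in> co_turan_edges n r \<longleftrightarrow> i < n \<and> j < n \<and> i \<noteq> j \<and> i mod r = j mod r"
  unfolding co_turan_edges_def complement_edges_def turan_edges_def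
  by (auto simp: doubleton_eq_iff)

lemma fin_sgraph_co_turan: "fin_sgraph {..<n} (co_turan_edges n r)"
  by (auto simp: fin_sgraph_def co_turan_edges_def complement_edges_def)

lemma independence_number_co_turan:
  assumes "0 < r" "r \<le> n"
  shows "independence_number {..<n} (co_turan_edges n r) = r"
  unfolding independence_number_def
proof (rule Max_eqI)
  have "{card S | S. S \<subseteq> {..<n} \<and> indep S (co_turan_edges n r)} \<subseteq> card ` Pow {..<n}" by auto
  then show "finite {card S | S. S \<subseteq> {..<n} \<and> indep S (co_turan_edges n r)}"
    by (rule finite_subset) simp
next
  fix y assume "y \<in> {card S | S. S \<subseteq> {..<n} \<and> indep S (co_turan_edges n r)}"
  then obtain S where S: "y = card S" "S \<subseteq> {..<n}" "indep S (co_turan_edges n r)" by auto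
  have "inj_on (\<lambda>i. i mod r) S"
    using S(2,3) unfolding inj_on_def indep_def doubleton_in_co_turan_edges by blast
  moreover have "(\<lambda>i. i mod r) ` S \<subseteq> {..<r}" using assms by auto
  ultimately show "y \<le> r" using S(1) card_inj_on_le[of _ S "{..<r}"] by simp
next
  have "indep {..<r} (co_turan_edges n r)"
    by (auto simp: indep_def doubleton_in_co_turan_edges)
  moreover have "{..<r} \<subseteq> {..<n}" "card {..<r} = r" using assms by auto
  ultimately show "r \<in> {card S | S. S \<subseteq> {..<n} \<and> indep S (co_turan_edges n r)}"
    by force
qed

lemma min_cliques_attained:
  assumes "2 \<le> l"
  shows "\<exists>V E. admissible n l V E \<and> num_cliques k V E = min_cliques n k l"
proof -
  have "independence_number {..<n} ([{..<n}]\<^bsup>2\<^esup>) \<le> 1"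
    unfolding independence_number_def
  proof (rule Max.boundedI)
    have "{card S | S. S \<subseteq> {..<n} \<and> indep S ([{..<n}]\<^bsup>2\<^esup>)} \<subseteq> card ` Pow {..<n}" by auto
    then show "finite {card S | S. S \<subseteq> {..<n} \<and> indep S ([{..<n}]\<^bsup>2\<^esup>)}"
      by (rule finite_subset) simp
    show "{card S | S. S \<subseteq> {..<n} \<and> indep S ([{..<n}]\<^bsup>2\<^esup>)} \<noteq> {}"
      by (auto simp: indep_def)
  next
    fix y assume "y \<in> {card S | S. S \<subseteq> {..<n} \<and> indep S ([{..<n}]\<^bsup>2\<^esup>)}"
    then obtain S where S: "y = card S" "S \<subseteq> {..<n}" "indep S ([{..<n}]\<^bsup>2\<^esup>)" by auto
    have "finite S" using S(2) finite_subset by blast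
    moreover have "a = b" if "a \<in> S" "b \<in> S" for a b
      using S(2,3) that by (auto simp: indep_def)
    ultimately show "y \<le> 1" using S(1) by (simp add: card_le_Suc0_iff_eq)
  qed
  then have "admissible n l {..<n} ([{..<n}]\<^bsup>2\<^esup>)"
    using assms by (simp add: admissible_def fin_sgraph_def)
  then have "{num_cliques k V E | V E. admissible n l V E} \<noteq> {}" by blast
  then have "min_cliques n k l \<in> {num_cliques k V E | V E. admissible n l V E}"
    unfolding min_cliques_def by (rule Inf_nat_def1)
  then obtain V E where "min_cliques n k l = num_cliques k V E" "admissible n l V E" by blast
  then show ?thesis by metis
qed

end

theory Submission
  imports Defs "HOL-Combinatorics.Multiset_Permutations" "HOL-Probability.Product_PMF"
    "HOL-Real_Asymp.Real_Asymp"
begin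

text \<open>
  Replace \<open>s\<close> of the \<open>l - 1\<close> cliques by a balanced clique blow-up of a fixed pattern graph on \<open>m\<close>
  vertices with independence number at most \<open>s\<close>. This does not raise the independence number
  beyond \<open>l - 1\<close>. If \<open>w\<close> counts the ordered \<open>k\<close>-tuples of pattern vertices, repetitions allowed,
  whose entries are pairwise equal or adjacent, the blow-up on \<open>M\<close> vertices has about
  \<open>w (M / m)\<^sup>k / k!\<close> cliques of size \<open>k\<close>, compared with \<open>s (M / s)\<^sup>k / k!\<close> before. So it wins for
  large \<open>n\<close> as soon as \<open>w s\<^bsup>k-1\<^esup> < m\<^sup>k\<close>.

  For \<open>k \<ge> 4\<close> the pentagon works, with \<open>s = 2\<close> and \<open>w \<le> 5 (2\<^sup>k - 1)\<close>. For \<open>k = 3\<close> take \<open>s = 2073\<close>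
  and a random graph on \<open>m = 79 \<cdot> 2074 = 163846\<close> vertices with edge probability \<open>p = 0.005165\<close>:
  the expectation of \<open>w s\<^sup>2 / m\<^sup>3\<close> plus the expected number of independent 2074-sets is below 1.
\<close>

section \<open>Cliques and independent sets\<close>

lemma clique_iff_nsets_subset: "clique S E \<longleftrightarrow> [S]\<^bsup>2\<^esup> \<subseteq> E"
  by (auto simp: clique_def nsets_2_eq)

lemma indep_iff_nsets_disjoint: "indep S E \<longleftrightarrow> [S]\<^bsup>2\<^esup> \<inter> E = {}"
  by (auto simp: indep_def nsets_2_eq)

lemma independence_number_le_iff:
  assumes "finite V"
  shows "independence_number V E \<le> r \<longleftrightarrow> (\<forall>S\<subseteq>V. indep S E \<longrightarrow> card S \<le> r)"
proof -
  have "{card S | S. S \<subseteq> V \<and> indep S E} \<subseteq> card ` Pow V" by auto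
  then have "finite {card S | S. S \<subseteq> V \<and> indep S E}"
    by (rule finite_subset) (simp add: assms)
  moreover have "{card S | S. S \<subseteq> V \<and> indep S E} \<noteq> {}"
    using null_indep by blast
  ultimately show ?thesis
    unfolding independence_number_def by (subst Max_le_iff) auto
qed

lemma card_indep_le:
  assumes "finite V" "S \<subseteq> V" "indep S E"
  shows "card S \<le> independence_number V E"
  using assms independence_number_le_iff[of V E "independence_number V E"] by simp

definition cliques :: "nat \<Rightarrow> 'a set \<Rightarrow> 'a set set \<Rightarrow> 'a set set" where
  "cliques k V E = {S. S \<subseteq> V \<and> card S = k \<and> clique S E}"

lemma num_cliques_eq_card_cliques: "num_cliques k V E = card (cliques k V E)"
  by (simp add: num_cliques_def cliques_def)

lemma finite_cliques: "finite V \<Longrightarrow> finite (cliques k V E)"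
  by (simp add: cliques_def)

lemma num_cliques_complete:
  assumes "finite V" "clique V E"
  shows "num_cliques k V E = card V choose k"
  unfolding num_cliques_def using assms smaller_clique[OF assms(2)]
  by (simp add: n_subsets[symmetric] cong: conj_cong)

section \<open>Blow-ups\<close>

definition clique_blowup :: "'b set \<Rightarrow> ('b \<Rightarrow> 'a) \<Rightarrow> 'a set set \<Rightarrow> 'b set set" where
  "clique_blowup V \<phi> D =
     {{x, y} | x y. x \<in> V \<and> y \<in> V \<and> x \<noteq> y \<and> (\<phi> x = \<phi> y \<or> {\<phi> x, \<phi> y} \<in> D)}"

lemma doubleton_in_clique_blowup:
  "{x, y} \<in> clique_blowup V \<phi> D \<longleftrightarrow>
     x \<in> V \<and> y \<in> V \<and> x \<noteq> y \<and> (\<phi> x = \<phi> y \<or> {\<phi> x, \<phi> y} \<in> D)"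
  by (auto simp: clique_blowup_def doubleton_eq_iff insert_commute)

lemma fin_sgraph_clique_blowup: "finite V \<Longrightarrow> fin_sgraph V (clique_blowup V \<phi> D)"
  by (auto simp: fin_sgraph_def clique_blowup_def)

lemma clique_image_if_clique_blowup: "clique S (clique_blowup V \<phi> D) \<Longrightarrow> clique (\<phi> ` S) D"
  by (auto simp: clique_def doubleton_in_clique_blowup)

lemma independence_number_clique_blowup_le:
  assumes "finite V" "finite W" "\<phi> ` V \<subseteq> W"
  shows "independence_number V (clique_blowup V \<phi> D) \<le> independence_number W D"
  unfolding independence_number_le_iff[OF assms(1)]
proof (intro allI impI)
  fix S assume S: "S \<subseteq> V" "indep S (clique_blowup V \<phi> D)"
  then have "inj_on \<phi> S"
    by (auto simp: inj_on_def indep_def doubleton_in_clique_blowup)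
  then have "card S = card (\<phi> ` S)" by (simp add: card_image)
  also have "\<dots> \<le> independence_number W D"
  proof (rule card_indep_le[OF assms(2)])
    show "\<phi> ` S \<subseteq> W" using S(1) assms(3) by blast
    show "indep (\<phi> ` S) D"
      using S by (auto simp: indep_def doubleton_in_clique_blowup subset_iff)
  qed
  finally show "card S \<le> independence_number W D" .
qed

lemma min_cliques_le_clique_blowup:
  assumes "finite W" "independence_number W D < l" "\<phi> ` {..<n} \<subseteq> W"
  shows "min_cliques n k l \<le> num_cliques k {..<n} (clique_blowup {..<n} \<phi> D)"
proof -
  have "admissible n l {..<n} (clique_blowup {..<n} \<phi> D)"
    using independence_number_clique_blowup_le[OF finite_lessThan assms(1,3), of D] assms(2)
    by (simp add: admissible_def fin_sgraph_clique_blowup)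
  then show ?thesis
    unfolding min_cliques_def by (intro cInf_lower) auto
qed

lemma min_cliques_le_num_cliques:
  assumes "finite W" "independence_number W D < l"
  shows "min_cliques (card W) k l \<le> num_cliques k W D"
proof -
  obtain \<phi> where \<phi>: "bij_betw \<phi> {..<card W} W"
    using ex_bij_betw_nat_finite[OF assms(1)] by (auto simp: atLeast0LessThan)
  let ?E = "clique_blowup {..<card W} \<phi> D"
  have inj: "inj_on \<phi> S" if "S \<subseteq> {..<card W}" for S
    using that \<phi> inj_on_subset by (auto simp: bij_betw_def)
  have "min_cliques (card W) k l \<le> num_cliques k {..<card W} ?E"
    using \<phi> assms by (intro min_cliques_le_clique_blowup) (auto simp: bij_betw_def)
  also have "\<dots> \<le> num_cliques k W D"
    unfolding num_cliques_eq_card_cliques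
  proof (rule card_inj_on_le[where f = "(`) \<phi>"])
    show "inj_on ((`) \<phi>) (cliques k {..<card W} ?E)"
      by (rule inj_on_subset[OF inj_on_image_Pow[OF inj[OF order_refl]]]) (auto simp: cliques_def)
    show "(`) \<phi> ` cliques k {..<card W} ?E \<subseteq> cliques k W D"
      using \<phi> inj clique_image_if_clique_blowup
      by (fastforce simp: cliques_def card_image bij_betw_def)
  qed (rule finite_cliques[OF assms(1)])
  finally show ?thesis .
qed

section \<open>Disjoint unions\<close>

definition Plus_edges :: "'a set set \<Rightarrow> 'b set set \<Rightarrow> ('a + 'b) set set" where
  "Plus_edges E F = {{Inl x, Inl y} | x y. {x, y} \<in> E} \<union> {{Inr u, Inr v} | u v. {u, v} \<in> F}"

lemma doubleton_in_Plus_edges [simp]: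
  "{Inl x, Inl y} \<in> Plus_edges E F \<longleftrightarrow> {x, y} \<in> E"
  "{Inr u, Inr v} \<in> Plus_edges E F \<longleftrightarrow> {u, v} \<in> F"
  "{Inl x, Inr v} \<notin> Plus_edges E F"
  by (auto simp: Plus_edges_def doubleton_eq_iff insert_commute)

lemma set_eq_Plus_vimages: "S = (Inl -` S) <+> (Inr -` S)"
proof -
  have "x \<in> S \<longleftrightarrow> x \<in> (Inl -` S) <+> (Inr -` S)" for x by (cases x) auto
  then show ?thesis by blast
qed

lemma independence_number_Plus_le:
  assumes "finite V" "finite W"
  shows "independence_number (V <+> W) (Plus_edges E F)
    \<le> independence_number V E + independence_number W F"
  unfolding independence_number_le_iff[OF finite_Plus[OF assms]]
proof (intro allI impI)
  fix S assume S: "S \<subseteq> V <+> W" "indep S (Plus_edges E F)"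
  have sub: "Inl -` S \<subseteq> V" "Inr -` S \<subseteq> W" using S(1) by auto
  have indep: "indep (Inl -` S) E" "indep (Inr -` S) F"
    using S(2) by (fastforce simp: indep_def)+
  have "card S = card ((Inl -` S) <+> (Inr -` S))" by (subst set_eq_Plus_vimages) (rule refl)
  also have "\<dots> = card (Inl -` S) + card (Inr -` S)"
    using sub assms by (intro card_Plus) (auto intro: finite_subset)
  also have "\<dots> \<le> independence_number V E + independence_number W F"
    using assms sub indep by (intro add_mono card_indep_le)
  finally show "card S \<le> independence_number V E + independence_number W F" .
qed

lemma clique_Plus_edges_cases:
  assumes "clique S (Plus_edges E F)"
  obtains A where "S = Inl ` A" "clique A E" | B where "S = Inr ` B" "clique B F"
proof -
  have "\<not> (Inl x \<in> S \<and> Inr y \<in> S)" for x y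
    using assms by (fastforce simp: clique_def)
  then have "S \<inter> range Inl = {} \<or> S \<inter> range Inr = {}" by blast
  moreover have "S = (S \<inter> range Inl) \<union> (S \<inter> range Inr)"
    by (simp flip: Int_Un_distrib UNIV_sum)
  ultimately have "S = Inl ` (Inl -` S) \<or> S = Inr ` (Inr -` S)"
    unfolding image_vimage_eq by (elim disjE) simp_all
  moreover have "clique (Inl -` S) E" "clique (Inr -` S) F"
    using assms by (fastforce simp: clique_def)+
  ultimately show ?thesis using that(1)[of "Inl -` S"] that(2)[of "Inr -` S"] by argo
qed

lemma num_cliques_Plus_le:
  assumes "finite V" "finite W"
  shows "num_cliques k (V <+> W) (Plus_edges E F) \<le> num_cliques k V E + num_cliques k W F"
proof -
  have fin: "finite (cliques k V E)" "finite (cliques k W F)"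
    using assms by (simp_all add: finite_cliques)
  have "cliques k (V <+> W) (Plus_edges E F) \<subseteq> (`) Inl ` cliques k V E \<union> (`) Inr ` cliques k W F"
  proof
    fix S assume "S \<in> cliques k (V <+> W) (Plus_edges E F)"
    then have S: "S \<subseteq> V <+> W" "card S = k" "clique S (Plus_edges E F)"
      by (auto simp: cliques_def)
    from S(3) show "S \<in> (`) Inl ` cliques k V E \<union> (`) Inr ` cliques k W F"
    proof (cases rule: clique_Plus_edges_cases)
      case (1 A)
      then have "A \<in> cliques k V E" using S(1,2) by (auto simp: cliques_def card_image)
      then show ?thesis using 1(1) by blast
    next
      case (2 B)
      then have "B \<in> cliques k W F" using S(1,2) by (auto simp: cliques_def card_image)
      then show ?thesis using 2(1) by blast
    qed
  qed
  then have "num_cliques k (V <+> W) (Plus_edges E F)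
      \<le> card ((`) Inl ` cliques k V E \<union> (`) Inr ` cliques k W F)"
    unfolding num_cliques_eq_card_cliques using fin by (intro card_mono) auto
  also have "\<dots> \<le> card (cliques k V E) + card (cliques k W F)"
    using fin by (intro order_trans[OF card_Un_le] add_mono card_image_le)
  finally show ?thesis by (simp add: num_cliques_eq_card_cliques)
qed

lemma min_cliques_add_le:
  assumes "1 \<le> s" "1 \<le> t"
  shows "min_cliques (m + n) k (Suc (s + t)) \<le> min_cliques m k (Suc s) + min_cliques n k (Suc t)"
proof -
  obtain V E where E: "admissible m (Suc s) V E" "num_cliques k V E = min_cliques m k (Suc s)"
    using min_cliques_attained[of "Suc s" m k] assms(1) by auto
  obtain W F where F: "admissible n (Suc t) W F" "num_cliques k W F = min_cliques n k (Suc t)"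
    using min_cliques_attained[of "Suc t" n k] assms(2) by auto
  have fin: "finite V" "finite W" and card: "card V = m" "card W = n"
    using E(1) F(1) by (auto simp: admissible_def fin_sgraph_def)
  have "independence_number (V <+> W) (Plus_edges E F) < Suc (s + t)"
    using independence_number_Plus_le[OF fin, of E F] E(1) F(1) by (auto simp: admissible_def)
  then have "min_cliques (card (V <+> W)) k (Suc (s + t))
      \<le> num_cliques k (V <+> W) (Plus_edges E F)"
    using fin by (intro min_cliques_le_num_cliques) auto
  also have "\<dots> \<le> min_cliques m k (Suc s) + min_cliques n k (Suc t)"
    using num_cliques_Plus_le[OF fin, of k E F] E(2) F(2) by simp
  finally show ?thesis by (simp add: card_Plus fin card)
qed

lemma min_cliques_2_le: "min_cliques n k 2 \<le> n choose k"
proof -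
  have "clique {..<n} ([{..<n}]\<^bsup>2\<^esup>)" by (simp add: clique_iff_nsets_subset)
  moreover have "independence_number {..<n} ([{..<n}]\<^bsup>2\<^esup>) \<le> 1"
    unfolding independence_number_le_iff[OF finite_lessThan]
  proof (intro allI impI)
    fix S assume S: "S \<subseteq> {..<n}" "indep S ([{..<n}]\<^bsup>2\<^esup>)"
    then have "x = y" if "x \<in> S" "y \<in> S" for x y using that by (auto simp: indep_def)
    then show "card S \<le> 1"
      using finite_subset[OF S(1)] by (simp add: card_le_Suc0_iff_eq)
  qed
  ultimately show ?thesis
    using min_cliques_le_num_cliques[of "{..<n}" "[{..<n}]\<^bsup>2\<^esup>" 2 k]
      num_cliques_complete[of "{..<n}"]
    by simp
qed

lemma min_cliques_add_cliques_le:
  assumes "1 \<le> s" "finite C"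
  shows "min_cliques (m + (\<Sum>c\<in>C. a c)) k (Suc (s + card C))
    \<le> min_cliques m k (Suc s) + (\<Sum>c\<in>C. a c choose k)"
  using assms(2)
proof (induction C rule: finite_induct)
  case (insert c C)
  have "min_cliques (m + (\<Sum>c\<in>insert c C. a c)) k (Suc (s + card (insert c C)))
      = min_cliques ((m + (\<Sum>c\<in>C. a c)) + a c) k (Suc ((s + card C) + 1))"
    using insert.hyps by (simp add: ac_simps)
  also have "\<dots> \<le> min_cliques (m + (\<Sum>c\<in>C. a c)) k (Suc (s + card C)) + min_cliques (a c) k 2"
    using min_cliques_add_le[of "s + card C" 1] assms(1) by (simp add: numeral_2_eq_2)
  also have "\<dots> \<le> (min_cliques m k (Suc s) + (\<Sum>c\<in>C. a c choose k)) + (a c choose k)"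
    by (rule add_mono[OF insert.IH min_cliques_2_le])
  finally show ?case using insert.hyps by (simp add: ac_simps)
qed simp

section \<open>Counting the cliques of a blow-up\<close>

text \<open>
  Clique lists may repeat vertices: \<open>card (clique_lists k W D)\<close> counts homomorphisms from the
  complete graph on \<open>k\<close> vertices to \<open>D\<close> with a loop added at every vertex.
\<close>

definition clique_lists :: "nat \<Rightarrow> 'a set \<Rightarrow> 'a set set \<Rightarrow> 'a list set" where
  "clique_lists k W D = {xs. set xs \<subseteq> W \<and> length xs = k \<and> clique (set xs) D}"

lemma finite_clique_lists: "finite W \<Longrightarrow> finite (clique_lists k W D)"
  by (rule finite_subset[OF _ finite_lists_length_eq[of W k]]) (auto simp: clique_lists_def)

lemma num_cliques_times_fact_le_card_clique_lists:
  assumes "finite V"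
  shows "num_cliques k V E * fact k \<le> card (clique_lists k V E)"
proof -
  have fin: "finite S" if "S \<in> cliques k V E" for S
    using that assms finite_subset by (auto simp: cliques_def)
  have "num_cliques k V E * fact k = (\<Sum>S\<in>cliques k V E. card (permutations_of_set S))"
    using fin by (simp add: num_cliques_eq_card_cliques) (simp add: cliques_def)
  also have "\<dots> = card (\<Union>S\<in>cliques k V E. permutations_of_set S)"
    using assms
    by (intro card_UN_disjoint[symmetric]) (auto simp: finite_cliques dest: permutations_of_setD)
  also have "\<dots> \<le> card (clique_lists k V E)"
    by (intro card_mono finite_clique_lists assms)
      (auto simp: cliques_def clique_lists_def permutations_of_set_def distinct_card)
  finally show ?thesis .
qed

lemma card_map_fibre_le:
  assumes "finite V" "\<And>w. card {x \<in> V. \<phi> x = w} \<le> b"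
  shows "card {xs. set xs \<subseteq> V \<and> map \<phi> xs = ws} \<le> b ^ length ws"
proof (induction ws)
  case Nil
  have "{xs. set xs \<subseteq> V \<and> map \<phi> xs = []} = {[]}" by auto
  then show ?case by simp
next
  case (Cons w ws)
  let ?X = "{x \<in> V. \<phi> x = w}" and ?L = "{xs. set xs \<subseteq> V \<and> map \<phi> xs = ws}"
  have "finite ?L"
    by (rule finite_subset[OF _ finite_lists_length_eq[OF assms(1), of "length ws"]]) auto
  moreover have "{xs. set xs \<subseteq> V \<and> map \<phi> xs = w # ws} = (\<lambda>(x, xs). x # xs) ` (?X \<times> ?L)"
    by (auto simp: map_eq_Cons_conv)
  ultimately have "card {xs. set xs \<subseteq> V \<and> map \<phi> xs = w # ws} \<le> card (?X \<times> ?L)"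
    using assms(1) by (simp only:) (intro card_image_le finite_cartesian_product, simp_all)
  also have "\<dots> = card ?X * card ?L" by (rule card_cartesian_product)
  also have "\<dots> \<le> b * b ^ length ws" by (intro mult_mono assms(2) Cons) auto
  finally show ?case by simp
qed

lemma card_clique_lists_clique_blowup_le:
  assumes "finite V" "finite W" "\<phi> ` V \<subseteq> W" "\<And>w. card {x \<in> V. \<phi> x = w} \<le> b"
  shows "card (clique_lists k V (clique_blowup V \<phi> D)) \<le> card (clique_lists k W D) * b ^ k"
proof -
  let ?fibre = "\<lambda>ws. {xs. set xs \<subseteq> V \<and> map \<phi> xs = ws}"
  have fin: "finite (clique_lists k W D)" by (rule finite_clique_lists[OF assms(2)])
  have "map \<phi> xs \<in> clique_lists k W D" if "xs \<in> clique_lists k V (clique_blowup V \<phi> D)" for xs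
    using that assms(3) clique_image_if_clique_blowup[of "set xs" V \<phi> D]
    by (auto simp: clique_lists_def)
  then have "clique_lists k V (clique_blowup V \<phi> D) \<subseteq> (\<Union>ws\<in>clique_lists k W D. ?fibre ws)"
    by (auto simp: clique_lists_def)
  moreover have "finite (\<Union>ws\<in>clique_lists k W D. ?fibre ws)"
    by (rule finite_subset[OF _ finite_lists_length_eq[OF assms(1), of k]])
      (auto simp: clique_lists_def)
  ultimately have "card (clique_lists k V (clique_blowup V \<phi> D))
      \<le> card (\<Union>ws\<in>clique_lists k W D. ?fibre ws)"
    by (intro card_mono)
  also have "\<dots> \<le> (\<Sum>ws\<in>clique_lists k W D. card (?fibre ws))" by (rule card_UN_le[OF fin])
  also have "\<dots> \<le> (\<Sum>ws\<in>clique_lists k W D. b ^ k)"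
    using card_map_fibre_le[OF assms(1,4)] by (intro sum_mono) (fastforce simp: clique_lists_def)
  finally show ?thesis by simp
qed

lemma min_cliques_times_fact_le:
  assumes "finite W" "W \<noteq> {}" "independence_number W D < l"
  shows "min_cliques n k l * fact k \<le> card (clique_lists k W D) * (n div card W + 1) ^ k"
proof -
  define m where "m = card W"
  have m: "0 < m" using assms by (simp add: m_def card_gt_0_iff)
  obtain h where h: "bij_betw h {..<m} W"
    using ex_bij_betw_nat_finite[OF assms(1)] by (auto simp: atLeast0LessThan m_def)
  define \<phi> where "\<phi> i = h (i mod m)" for i
  have range: "\<phi> ` {..<n} \<subseteq> W" using h m by (auto simp: \<phi>_def bij_betw_def)
  have fibre: "card {i \<in> {..<n}. \<phi> i = w} \<le> n div m + 1" for w
  proof (cases "w \<in> W")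
    case True
    then obtain c where c: "c < m" "w = h c" using h by (auto simp: bij_betw_def)
    have "\<phi> i = w \<longleftrightarrow> i mod m = c" for i
      using h m c by (auto simp: \<phi>_def bij_betw_def inj_on_def)
    then show ?thesis using c(1) by (simp add: turan_part_card)
  next
    case False
    then have "{i \<in> {..<n}. \<phi> i = w} = {}" using range by blast
    then show ?thesis by (simp only: card.empty)
  qed
  have "min_cliques n k l * fact k \<le> num_cliques k {..<n} (clique_blowup {..<n} \<phi> D) * fact k"
    by (intro mult_right_mono min_cliques_le_clique_blowup[OF assms(1,3) range]) simp
  also have "\<dots> \<le> card (clique_lists k {..<n} (clique_blowup {..<n} \<phi> D))"
    by (rule num_cliques_times_fact_le_card_clique_lists) simp
  also have "\<dots> \<le> card (clique_lists k W D) * (n div m + 1) ^ k"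
    by (rule card_clique_lists_clique_blowup_le[OF finite_lessThan assms(1) range fibre])
  finally show ?thesis by (simp add: m_def)
qed

section \<open>Comparison with the complement of the Turan graph\<close>

lemma cliques_co_turan:
  assumes "1 \<le> k" "1 \<le> r"
  shows "cliques k {..<n} (co_turan_edges n r)
    = (\<Union>c<r. {S. S \<subseteq> {i. i < n \<and> i mod r = c} \<and> card S = k})"
proof (intro equalityI subsetI)
  fix S assume "S \<in> cliques k {..<n} (co_turan_edges n r)"
  then have S: "S \<subseteq> {..<n}" "card S = k" "clique S (co_turan_edges n r)"
    by (auto simp: cliques_def)
  then obtain i where "i \<in> S" using assms(1) by fastforce
  then have "S \<subseteq> {j. j < n \<and> j mod r = i mod r}"
    using S(1,3) by (auto simp: clique_def doubleton_in_co_turan_edges)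
  then show "S \<in> (\<Union>c<r. {S. S \<subseteq> {i. i < n \<and> i mod r = c} \<and> card S = k})"
    using S(2) assms(2) by auto
qed (auto simp: cliques_def clique_def doubleton_in_co_turan_edges)

lemma num_cliques_co_turan:
  assumes "1 \<le> k" "1 \<le> r"
  shows "num_cliques k {..<n} (co_turan_edges n r)
    = (\<Sum>c<r. card {i. i < n \<and> i mod r = c} choose k)"
proof -
  let ?sets = "\<lambda>c. {S. S \<subseteq> {i. i < n \<and> i mod r = c} \<and> card S = k}"
  have "num_cliques k {..<n} (co_turan_edges n r) = card (\<Union>c<r. ?sets c)"
    by (simp add: num_cliques_eq_card_cliques cliques_co_turan[OF assms])
  also have "\<dots> = (\<Sum>c<r. card (?sets c))"
  proof (rule card_UN_disjoint)
    have "S \<noteq> {}" if "card S = k" for S :: "nat set" using that assms(1) by auto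
    then show "\<forall>c\<in>{..<r}. \<forall>d\<in>{..<r}. c \<noteq> d \<longrightarrow> ?sets c \<inter> ?sets d = {}"
      by blast
  qed auto
  finally show ?thesis by (simp add: n_subsets)
qed

lemma binomial_times_fact: "real (n choose k) * fact k = (\<Prod>i<k. real n - real i)"
  by (simp add: binomial_gbinomial gbinomial_mult_fact' atLeast0LessThan)

lemma binomial_times_fact_over_power_tendsto:
  "(\<lambda>n. real (n choose k) * fact k / real n ^ k) \<longlonglongrightarrow> 1"
proof -
  have "(\<lambda>n. \<Prod>i<k. 1 - real i / real n) \<longlonglongrightarrow> (\<Prod>i<k. 1 - 0)"
    by (intro tendsto_prod tendsto_diff tendsto_const lim_const_over_n)
  moreover have "\<forall>\<^sub>F n in sequentially.
      (\<Prod>i<k. 1 - real i / real n) = real (n choose k) * fact k / real n ^ k"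
    using eventually_gt_at_top[of 0]
  proof eventually_elim
    case (elim n)
    have "real (n choose k) * fact k / real n ^ k = (\<Prod>i<k. (real n - real i) / real n)"
      by (simp add: binomial_times_fact prod_dividef)
    also have "\<dots> = (\<Prod>i<k. 1 - real i / real n)"
      using elim by (intro prod.cong) (auto simp: field_simps)
    finally show ?case by simp
  qed
  ultimately show ?thesis by (simp add: tendsto_cong)
qed

lemma eventually_blowup_count_less_binomial:
  fixes w s m k :: nat
  assumes "0 < m" "0 < s" "1 \<le> k" "w * s ^ (k - 1) < m ^ k"
  shows "\<forall>\<^sub>F q in sequentially. w * (s * (q + 1) div m + 1) ^ k < s * (q choose k) * fact k"
proof -
  define B where "B q = real s * (real q + 1) / m + 1" for q :: nat
  have "(\<lambda>q. B q / q) \<longlonglongrightarrow> s / m"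
    unfolding B_def divide_inverse using assms(1,2) by real_asymp
  then have "(\<lambda>q. s * (real (q choose k) * fact k / real q ^ k) - w * (B q / q) ^ k)
      \<longlonglongrightarrow> real s * 1 - w * (s / m) ^ k"
    by (intro tendsto_diff tendsto_mult tendsto_power tendsto_const
        binomial_times_fact_over_power_tendsto)
  moreover have "0 < real s * 1 - w * (s / m) ^ k"
  proof -
    have "w * s ^ k = s * (w * s ^ (k - 1))" using assms(3) by (cases k) auto
    also have "\<dots> < s * m ^ k" using assms(2,4) by simp
    finally have "real w * s ^ k < real s * m ^ k"
      by (simp only: flip: of_nat_power of_nat_mult of_nat_less_iff[where 'a = real])
    then show ?thesis using assms(1) by (simp add: power_divide divide_less_eq)
  qed
  ultimately have "\<forall>\<^sub>F q in sequentially.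
      0 < s * (real (q choose k) * fact k / real q ^ k) - w * (B q / q) ^ k"
    by (rule order_tendstoD(1))
  then show ?thesis
    using eventually_gt_at_top[of 0]
  proof eventually_elim
    case (elim q)
    define b where "b = s * (q + 1) div m + 1"
    have "b \<le> B q"
      using of_nat_div_le_of_nat[of "s * (q + 1)" m, where 'a = real]
      by (simp add: b_def B_def algebra_simps)
    then have "w * real b ^ k \<le> w * B q ^ k" by (intro mult_left_mono power_mono) auto
    also have "\<dots> < s * (real (q choose k) * fact k)"
      using elim by (simp add: power_divide field_simps)
    finally have "real (w * b ^ k) < real (s * (q choose k) * fact k)" by simp
    then show ?case unfolding b_def of_nat_less_iff .
  qed
qed

lemma sum_card_residue_classes:
  assumes "1 \<le> r"
  shows "(\<Sum>c<r. card {i. i < n \<and> i mod r = c}) = n"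
  using sum.group[of "{..<n}" "{..<r}" "\<lambda>i. i mod r" "\<lambda>_. 1::nat"] assms
  by (simp add: image_subset_iff)

lemma min_cliques_less_num_cliques_co_turan:
  fixes W :: "'a set"
  assumes W: "finite W" "W \<noteq> {}" "independence_number W D \<le> s"
    and k: "1 \<le> k" and s: "1 \<le> s" "s \<le> r"
    and few: "card (clique_lists k W D) * (s * (n div r + 1) div card W + 1) ^ k
      < s * (n div r choose k) * fact k"
  shows "min_cliques n k (Suc r) < num_cliques k {..<n} (co_turan_edges n r)"
proof -
  define a where "a c = card {i. i < n \<and> i mod r = c}" for c
  define M where "M = (\<Sum>c<s. a c)"
  have a: "n div r \<le> a c" "a c \<le> n div r + 1" if "c < r" for c
    using that by (simp_all add: a_def turan_part_card)
  have M: "M \<le> s * (n div r + 1)"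
    using sum_mono[of "{..<s}" a "\<lambda>_. n div r + 1"] a(2) s(2) by (simp add: M_def)
  have split: "(\<Sum>c<r. f c) = (\<Sum>c<s. f c) + (\<Sum>c\<in>{s..<r}. f c)" for f :: "nat \<Rightarrow> nat"
    using s(2) by (simp add: sum.atLeastLessThan_concat flip: atLeast0LessThan)
  have n: "n = M + (\<Sum>c\<in>{s..<r}. a c)"
    using sum_card_residue_classes[of r n] s split[of a] by (simp add: a_def M_def)
  have "min_cliques M k (Suc s) * fact k \<le> card (clique_lists k W D) * (M div card W + 1) ^ k"
    using W(3) by (intro min_cliques_times_fact_le[OF W(1,2)]) simp
  also have "\<dots> \<le> card (clique_lists k W D) * (s * (n div r + 1) div card W + 1) ^ k"
    using M by (intro mult_left_mono power_mono add_right_mono div_le_mono) auto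
  also note few
  finally have "min_cliques M k (Suc s) < s * (n div r choose k)" by simp
  also have "\<dots> \<le> (\<Sum>c<s. a c choose k)"
    using sum_mono[of "{..<s}" "\<lambda>_. n div r choose k"] a(1) s(2)
    by (simp add: binomial_right_mono)
  finally have blowup: "min_cliques M k (Suc s) < (\<Sum>c<s. a c choose k)" .
  have "min_cliques n k (Suc r)
      = min_cliques (M + (\<Sum>c\<in>{s..<r}. a c)) k (Suc (s + card {s..<r}))"
    using n s(2) by simp
  also have "\<dots> \<le> min_cliques M k (Suc s) + (\<Sum>c\<in>{s..<r}. a c choose k)"
    by (intro min_cliques_add_cliques_le s(1)) simp
  also have "\<dots> < (\<Sum>c<r. a c choose k)" using blowup by (simp add: split)
  also have "\<dots> = num_cliques k {..<n} (co_turan_edges n r)"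
    using k s by (simp add: num_cliques_co_turan a_def)
  finally show ?thesis .
qed

definition sparse_pattern :: "nat \<Rightarrow> nat \<Rightarrow> 'a set \<Rightarrow> 'a set set \<Rightarrow> bool" where
  "sparse_pattern k s W D \<longleftrightarrow> fin_sgraph W D \<and> independence_number W D \<le> s \<and>
     card (clique_lists k W D) * s ^ (k - 1) < card W ^ k"

lemma eventually_min_cliques_less_if_sparse_pattern:
  assumes "sparse_pattern k s W D" "1 \<le> k" "1 \<le> s" "s \<le> r"
  shows "\<forall>\<^sub>F n in sequentially.
    min_cliques n k (Suc r) < num_cliques k {..<n} (co_turan_edges n r)"
proof -
  let ?w = "card (clique_lists k W D)"
  have W: "finite W" "independence_number W D \<le> s" "?w * s ^ (k - 1) < card W ^ k"
    using assms(1) by (auto simp: sparse_pattern_def fin_sgraph_def)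
  then have nonempty: "W \<noteq> {}" using assms(2) by (auto simp: power_0_left)
  have "\<forall>\<^sub>F q in sequentially.
      ?w * (s * (q + 1) div card W + 1) ^ k < s * (q choose k) * fact k"
    using W nonempty assms(2,3)
    by (intro eventually_blowup_count_less_binomial) (auto simp: card_gt_0_iff)
  moreover have "filterlim (\<lambda>n. n div r) sequentially sequentially"
    using assms(3,4) by (intro filterlim_at_top_div_const_nat) simp
  ultimately have "\<forall>\<^sub>F n in sequentially.
      ?w * (s * (n div r + 1) div card W + 1) ^ k < s * (n div r choose k) * fact k"
    by (rule eventually_compose_filterlim)
  then show ?thesis
    by eventually_elim
      (rule min_cliques_less_num_cliques_co_turan[OF W(1) nonempty W(2) assms(2-4)])
qed

section \<open>The pentagon\<close>

lemma in_replicate_image_if_card_set_1: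
  assumes "card (set xs) = 1" "set xs \<subseteq> A" "length xs = k"
  shows "xs \<in> replicate k ` A"
proof -
  obtain x where x: "set xs = {x}" using assms(1) by (auto simp: card_1_singleton_iff)
  then have "xs = replicate k x" using assms(3) by (intro replicate_eqI) auto
  then show ?thesis using x assms(2) by blast
qed

lemma card_lists_onto_doubleton:
  assumes "card e = 2" "1 \<le> k"
  shows "card {xs. set xs = e \<and> length xs = k} = 2 ^ k - 2"
proof -
  have fin: "finite e" using assms(1) by (intro card_ge_0_finite) simp
  have inj: "inj_on (replicate k) e" using assms(2) by (auto simp: inj_on_def)
  have "set xs = e" if xs: "set xs \<subseteq> e" "length xs = k" "xs \<notin> replicate k ` e" for xs
  proof (rule card_subset_eq[OF fin xs(1)])
    have "card (set xs) \<noteq> 0" using xs(2) assms(2) by auto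
    moreover have "card (set xs) \<noteq> 1" using in_replicate_image_if_card_set_1 xs by blast
    moreover have "card (set xs) \<le> 2" using card_mono[OF fin xs(1)] assms(1) by simp
    ultimately show "card (set xs) = card e" using assms(1) by linarith
  qed
  moreover have "set (replicate k x) \<noteq> e" for x using assms by auto
  ultimately have "{xs. set xs = e \<and> length xs = k}
      = {xs. set xs \<subseteq> e \<and> length xs = k} - replicate k ` e"
    by fastforce
  also have "card \<dots> = card {xs. set xs \<subseteq> e \<and> length xs = k} - card (replicate k ` e)"
    using fin by (intro card_Diff_subset) auto
  also have "\<dots> = 2 ^ k - 2"
    using assms(1) by (simp add: card_lists_length_eq[OF fin] card_image[OF inj])
  finally show ?thesis .
qed

lemma clique_lists_subset_if_triangle_free:
  assumes triangle_free: "\<And>S. S \<in> [W]\<^bsup>3\<^esup> \<Longrightarrow> \<not> clique S D" and "1 \<le> k"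
  shows "clique_lists k W D \<subseteq> replicate k ` W \<union> (\<Union>e\<in>D. {xs. set xs = e \<and> length xs = k})"
proof
  fix xs assume "xs \<in> clique_lists k W D"
  then have xs: "set xs \<subseteq> W" "length xs = k" "clique (set xs) D"
    by (auto simp: clique_lists_def)
  have "\<not> 3 \<le> card (set xs)"
  proof
    assume "3 \<le> card (set xs)"
    then obtain S where "S \<subseteq> set xs" "card S = 3" "finite S" by (rule obtain_subset_with_card_n)
    then show False
      using triangle_free[of S] smaller_clique[OF xs(3)] xs(1) by (auto simp: nsets_def)
  qed
  moreover have "card (set xs) \<noteq> 0" using xs(2) assms(2) by auto
  ultimately consider "card (set xs) = 1" | "card (set xs) = 2" by linarith
  then show "xs \<in> replicate k ` W \<union> (\<Union>e\<in>D. {xs. set xs = e \<and> length xs = k})"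
  proof cases
    case 1
    then show ?thesis using in_replicate_image_if_card_set_1 xs by blast
  next
    case 2
    then have "set xs \<in> D" using xs(3) by (auto simp: card_2_iff clique_def)
    then show ?thesis using xs(2) by blast
  qed
qed

lemma card_clique_lists_le_if_triangle_free:
  assumes graph: "fin_sgraph W D" and triangle_free: "\<And>S. S \<in> [W]\<^bsup>3\<^esup> \<Longrightarrow> \<not> clique S D"
    and k: "1 \<le> k"
  shows "card (clique_lists k W D) \<le> card W + card D * (2 ^ k - 2)"
proof -
  let ?onto = "\<lambda>e. {xs. set xs = e \<and> length xs = k}"
  have fin: "finite W" "finite D"
    using graph finite_subset finite_imp_finite_nsets[of W 2] by (auto simp: fin_sgraph_def)
  have edge: "finite e" "card e = 2" if "e \<in> D" for e
    using graph that by (auto simp: fin_sgraph_def nsets_def)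
  have "finite (?onto e)" if "e \<in> D" for e
    by (rule finite_subset[OF _ finite_lists_length_eq[OF edge(1)[OF that], of k]]) auto
  then have "card (clique_lists k W D) \<le> card (replicate k ` W \<union> (\<Union>e\<in>D. ?onto e))"
    using fin
    by (intro card_mono clique_lists_subset_if_triangle_free[OF triangle_free k]) auto
  also have "\<dots> \<le> card W + (\<Sum>e\<in>D. card (?onto e))"
    using fin by (intro order_trans[OF card_Un_le] add_mono card_image_le card_UN_le)
  also have "(\<Sum>e\<in>D. card (?onto e)) = (\<Sum>e\<in>D. 2 ^ k - 2)"
    using edge(2) k by (intro sum.cong card_lists_onto_doubleton) auto
  finally show ?thesis by simp
qed

definition pentagon :: "nat set set" where
  "pentagon = {{0, 1}, {1, 2}, {2, 3}, {3, 4}, {4, 0}}"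

lemma fin_sgraph_pentagon: "fin_sgraph {..<5} pentagon"
  by (auto simp: fin_sgraph_def pentagon_def)

lemma card_pentagon: "card pentagon = 5"
  by (simp add: pentagon_def doubleton_eq_iff)

lemma subset_lessThan_5_iff: "S \<subseteq> {..<5} \<longleftrightarrow> S \<in> Pow {0, 1, 2, 3, 4::nat}"
  by (simp add: eval_nat_numeral lessThan_Suc insert_commute)

lemma pentagon_triangle_free:
  assumes "S \<in> [{..<5}]\<^bsup>3\<^esup>"
  shows "\<not> clique S pentagon"
proof
  assume "clique S pentagon"
  then have "\<not> (0 \<in> S \<and> 2 \<in> S)" "\<not> (1 \<in> S \<and> 3 \<in> S)" "\<not> (2 \<in> S \<and> 4 \<in> S)"
    "\<not> (3 \<in> S \<and> 0 \<in> S)" "\<not> (4 \<in> S \<and> 1 \<in> S)"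
    by (force simp: clique_def pentagon_def doubleton_eq_iff)+
  then show False
    using assms by (auto simp: nsets_def subset_lessThan_5_iff Pow_insert)
qed

lemma independence_number_pentagon: "independence_number {..<5} pentagon \<le> 2"
  unfolding independence_number_le_iff[OF finite_lessThan]
proof (intro allI impI)
  fix S :: "nat set" assume S: "S \<subseteq> {..<5}" "indep S pentagon"
  then have "\<not> (0 \<in> S \<and> 1 \<in> S)" "\<not> (1 \<in> S \<and> 2 \<in> S)" "\<not> (2 \<in> S \<and> 3 \<in> S)"
    "\<not> (3 \<in> S \<and> 4 \<in> S)" "\<not> (4 \<in> S \<and> 0 \<in> S)"
    by (force simp: indep_def pentagon_def doubleton_eq_iff)+
  then show "card S \<le> 2" using S(1) by (auto simp: subset_lessThan_5_iff Pow_insert)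
qed

lemma pentagon_inequality:
  assumes "3 \<le> j"
  shows "(2 ^ Suc j - 1) * 2 ^ j < (5 ^ j :: nat)"
  using assms
proof (induction j rule: dec_induct)
  case (step j)
  define z :: nat where "z = 2 ^ Suc j"
  have "3 \<le> z" using power_increasing[of 2 "Suc j" "2::nat"] step(1) by (simp add: z_def)
  then have "(2 * z - 1) * 2 * 2 ^ j \<le> 5 * (z - 1) * 2 ^ j" by (intro mult_le_mono1) linarith
  then have "(2 ^ Suc (Suc j) - 1) * 2 ^ Suc j \<le> 5 * ((2 ^ Suc j - 1) * (2::nat) ^ j)"
    by (simp add: z_def mult.assoc)
  also have "\<dots> < 5 * 5 ^ j" using step.IH by linarith
  finally show ?case by simp
qed simp

lemma sparse_pattern_pentagon:
  assumes "4 \<le> k"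
  shows "sparse_pattern k 2 {..<5} pentagon"
proof -
  obtain j where k: "k = Suc j" "3 \<le> j" using assms by (cases k) auto
  have "card (clique_lists k {..<5} pentagon) \<le> 5 + 5 * (2 ^ k - 2)"
    using assms fin_sgraph_pentagon pentagon_triangle_free
      card_clique_lists_le_if_triangle_free[of "{..<5}" pentagon k]
    by (simp add: card_pentagon)
  also have "\<dots> = 5 * (2 ^ k - 1)"
    using power_increasing[of 1 k "2::nat"] assms by simp
  finally have "card (clique_lists k {..<5} pentagon) * 2 ^ (k - 1)
      \<le> 5 * ((2 ^ Suc j - 1) * 2 ^ j)"
    by (simp add: k(1))
  also have "\<dots> < 5 ^ k" using pentagon_inequality[OF k(2)] by (simp add: k(1))
  finally show ?thesis
    by (simp add: sparse_pattern_def fin_sgraph_pentagon independence_number_pentagon)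
qed

section \<open>Random patterns\<close>

definition random_subset_pmf :: "real \<Rightarrow> 'a set \<Rightarrow> 'a set pmf" where
  "random_subset_pmf p A = map_pmf (\<lambda>f. {x \<in> A. f x}) (Pi_pmf A False (\<lambda>_. bernoulli_pmf p))"

lemma set_random_subset_pmf: "set_pmf (random_subset_pmf p A) \<subseteq> Pow A"
  by (auto simp: random_subset_pmf_def)

lemma prob_Pi_pmf_eq_on:
  assumes "finite A" "F \<subseteq> A"
  shows "measure_pmf.prob (Pi_pmf A d (\<lambda>_. M)) {f. \<forall>x\<in>F. f x = b} = pmf M b ^ card F"
proof -
  have "{f. \<forall>x\<in>F. f x = b} = Pi A (\<lambda>x. if x \<in> F then {b} else UNIV)"
    using assms(2) by (auto simp: Pi_def)
  also have "measure_pmf.prob (Pi_pmf A d (\<lambda>_. M)) \<dots> = (\<Prod>x\<in>A. if x \<in> F then pmf M b else 1)"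
    unfolding measure_Pi_pmf_Pi[OF assms(1)]
    by (intro prod.cong) (auto simp: measure_pmf_single)
  also have "\<dots> = pmf M b ^ card F"
    using assms by (simp add: prod.If_cases Int_absorb1)
  finally show ?thesis .
qed

lemma prob_random_subset_superset:
  assumes "finite A" "F \<subseteq> A" "0 \<le> p" "p \<le> 1"
  shows "measure_pmf.prob (random_subset_pmf p A) {E. F \<subseteq> E} = p ^ card F"
proof -
  have "(\<lambda>f. {x \<in> A. f x}) -` {E. F \<subseteq> E} = {f. \<forall>x\<in>F. f x = True}" using assms(2) by auto
  then show ?thesis
    using assms by (simp only: random_subset_pmf_def measure_map_pmf prob_Pi_pmf_eq_on) simp
qed

lemma prob_random_subset_disjoint:
  assumes "finite A" "F \<subseteq> A" "0 \<le> p" "p \<le> 1"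
  shows "measure_pmf.prob (random_subset_pmf p A) {E. F \<inter> E = {}} = (1 - p) ^ card F"
proof -
  have "(\<lambda>f. {x \<in> A. f x}) -` {E. F \<inter> E = {}} = {f. \<forall>x\<in>F. f x = False}" using assms(2) by auto
  then show ?thesis
    using assms by (simp only: random_subset_pmf_def measure_map_pmf prob_Pi_pmf_eq_on) simp
qed

lemma expectation_card_filter:
  assumes "finite A"
  shows "measure_pmf.expectation M (\<lambda>\<omega>. real (card {x \<in> A. Q x \<omega>}))
    = (\<Sum>x\<in>A. measure_pmf.prob M {\<omega>. Q x \<omega>})"
proof -
  have "real (card {x \<in> A. Q x \<omega>}) = (\<Sum>x\<in>A. indicator {\<omega>. Q x \<omega>} \<omega>)" for \<omega>
    using assms by (simp add: indicator_def sum.If_cases Int_def)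
  then show ?thesis
    by (simp add: Bochner_Integration.integral_sum integrable_real_indicator
        measure_pmf.emeasure_eq_measure)
qed

lemma exists_less_if_expectation_less:
  fixes X :: "'a \<Rightarrow> real"
  assumes "finite (set_pmf M)" "measure_pmf.expectation M X < c"
  shows "\<exists>\<omega>\<in>set_pmf M. X \<omega> < c"
proof (rule ccontr)
  assume "\<not> ?thesis"
  then have "AE \<omega> in measure_pmf M. c \<le> X \<omega>" by (auto simp: AE_measure_pmf_iff)
  then have "c \<le> measure_pmf.expectation M X"
    by (intro measure_pmf.integral_ge_const integrable_measure_pmf_finite assms(1))
  then show False using assms(2) by simp
qed

text \<open>
  An entry added to a list with \<open>j\<close> distinct entries repeats one of these or is one of the other
  \<open>m - j\<close> letters.
\<close>

primrec list_weight :: "real \<Rightarrow> (nat \<Rightarrow> real) \<Rightarrow> nat \<Rightarrow> nat \<Rightarrow> real" where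
  "list_weight m g 0 j = g j"
| "list_weight m g (Suc k) j =
     real j * list_weight m g k j + (m - real j) * list_weight m g k (Suc j)"

lemma sum_lists_card_eq_list_weight:
  assumes "finite W" "S \<subseteq> W"
  shows "(\<Sum>xs | set xs \<subseteq> W \<and> length xs = k. g (card (S \<union> set xs)))
    = list_weight (real (card W)) g k (card S)"
  using assms(2)
proof (induction k arbitrary: S)
  case 0
  have "{xs. set xs \<subseteq> W \<and> length xs = 0} = {[]}" by auto
  then show ?case by simp
next
  case (Suc k)
  let ?L = "{xs. set xs \<subseteq> W \<and> length xs = k}" and ?w = "list_weight (real (card W)) g k"
  have S: "finite S" using Suc.prems assms(1) finite_subset by blast
  have "(\<Sum>xs | set xs \<subseteq> W \<and> length xs = Suc k. g (card (S \<union> set xs)))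
      = (\<Sum>(xs, x)\<in>?L \<times> W. g (card (S \<union> set (x # xs))))"
    unfolding lists_length_Suc_eq
    by (subst sum.reindex) (auto simp: inj_on_def case_prod_unfold)
  also have "\<dots> = (\<Sum>x\<in>W. \<Sum>xs\<in>?L. g (card (insert x S \<union> set xs)))"
    by (subst sum.cartesian_product[symmetric], subst sum.swap) simp
  also have "\<dots> = (\<Sum>x\<in>W. ?w (card (insert x S)))"
    using Suc.prems by (intro sum.cong refl Suc.IH) auto
  also have "\<dots> = (\<Sum>x\<in>S. ?w (card (insert x S))) + (\<Sum>x\<in>W - S. ?w (card (insert x S)))"
    using sum.subset_diff[OF Suc.prems assms(1)] by (simp add: add.commute)
  also have "\<dots> = list_weight (real (card W)) g (Suc k) (card S)"
    using S assms(1) Suc.prems by (simp add: insert_absorb card_Diff_subset card_mono of_nat_diff)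
  finally show ?case .
qed

abbreviation random_graph_pmf :: "real \<Rightarrow> 'a set \<Rightarrow> 'a set set pmf" where
  "random_graph_pmf p W \<equiv> random_subset_pmf p ([W]\<^bsup>2\<^esup>)"

lemma expectation_card_clique_lists:
  assumes "finite W" "0 \<le> p" "p \<le> 1"
  shows "measure_pmf.expectation (random_graph_pmf p W) (\<lambda>D. real (card (clique_lists k W D)))
    = list_weight (card W) (\<lambda>j. p ^ (j choose 2)) k 0"
proof -
  let ?L = "{xs. set xs \<subseteq> W \<and> length xs = k}"
  have "clique_lists k W D = {xs \<in> ?L. [set xs]\<^bsup>2\<^esup> \<subseteq> D}" for D
    by (auto simp: clique_lists_def clique_iff_nsets_subset)
  then have "measure_pmf.expectation (random_graph_pmf p W) (\<lambda>D. real (card (clique_lists k W D)))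
      = (\<Sum>xs\<in>?L. measure_pmf.prob (random_graph_pmf p W) {D. [set xs]\<^bsup>2\<^esup> \<subseteq> D})"
    by (simp only: expectation_card_filter[OF finite_lists_length_eq[OF assms(1)]])
  also have "\<dots> = (\<Sum>xs\<in>?L. p ^ (card (set xs) choose 2))"
    using assms by (intro sum.cong)
      (auto simp: prob_random_subset_superset finite_imp_finite_nsets nsets_mono)
  also have "\<dots> = list_weight (card W) (\<lambda>j. p ^ (j choose 2)) k 0"
    using sum_lists_card_eq_list_weight[OF assms(1), of "{}"] by simp
  finally show ?thesis .
qed

lemma expectation_card_indep_sets:
  assumes "finite W" "0 \<le> p" "p \<le> 1"
  shows "measure_pmf.expectation (random_graph_pmf p W)
      (\<lambda>D. real (card {S \<in> [W]\<^bsup>j\<^esup>. indep S D}))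
    = real (card W choose j) * (1 - p) ^ (j choose 2)"
proof -
  let ?M = "random_graph_pmf p W"
  have "measure_pmf.expectation ?M (\<lambda>D. real (card {S \<in> [W]\<^bsup>j\<^esup>. indep S D}))
      = (\<Sum>S\<in>[W]\<^bsup>j\<^esup>. measure_pmf.prob ?M {D. [S]\<^bsup>2\<^esup> \<inter> D = {}})"
    unfolding indep_iff_nsets_disjoint
    by (rule expectation_card_filter) (rule finite_imp_finite_nsets[OF assms(1)])
  also have "\<dots> = (\<Sum>S\<in>[W]\<^bsup>j\<^esup>. (1 - p) ^ (j choose 2))"
  proof (intro sum.cong refl)
    fix S assume "S \<in> [W]\<^bsup>j\<^esup>"
    then have "[S]\<^bsup>2\<^esup> \<subseteq> [W]\<^bsup>2\<^esup>" "card S = j" by (auto simp: nsets_def)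
    then show "measure_pmf.prob ?M {D. [S]\<^bsup>2\<^esup> \<inter> D = {}} = (1 - p) ^ (j choose 2)"
      using assms by (simp add: prob_random_subset_disjoint finite_imp_finite_nsets)
  qed
  finally show ?thesis by simp
qed

lemma independence_number_le_if_no_indep_Suc:
  assumes "finite W" "{S \<in> [W]\<^bsup>Suc s\<^esup>. indep S D} = {}"
  shows "independence_number W D \<le> s"
  unfolding independence_number_le_iff[OF assms(1)]
proof (intro allI impI, rule ccontr)
  fix S assume S: "S \<subseteq> W" "indep S D" "\<not> card S \<le> s"
  then obtain S' where S': "S' \<subseteq> S" "card S' = Suc s" "finite S'"
    by (meson not_less_eq_eq obtain_subset_with_card_n)
  then have "S' \<in> [W]\<^bsup>Suc s\<^esup>" using S(1) by (auto simp: nsets_def)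
  moreover have "indep S' D" by (rule smaller_indep[OF S(2) S'(1)])
  ultimately show False using assms(2) by blast
qed

lemma exists_sparse_pattern:
  fixes p :: real and W :: "'a set"
  assumes W: "finite W" "W \<noteq> {}" and p: "0 \<le> p" "p \<le> 1"
    and less: "list_weight (card W) (\<lambda>j. p ^ (j choose 2)) k 0
        * real s ^ (k - 1) / real (card W) ^ k
      + real (card W choose Suc s) * (1 - p) ^ (Suc s choose 2) < 1"
  shows "\<exists>D. sparse_pattern k s W D"
proof -
  define M where "M = random_graph_pmf p W"
  define c where "c = real s ^ (k - 1) / card W ^ k"
  let ?T = "\<lambda>D. card (clique_lists k W D)" and ?I = "\<lambda>D. card {S \<in> [W]\<^bsup>Suc s\<^esup>. indep S D}"
  have fin: "finite ([W]\<^bsup>j\<^esup>)" for j by (rule finite_imp_finite_nsets[OF W(1)])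
  have finM: "finite (set_pmf M)"
    using finite_subset[OF set_random_subset_pmf] fin by (auto simp: M_def)
  have "measure_pmf.expectation M (\<lambda>D. c * ?T D + ?I D)
      = c * measure_pmf.expectation M ?T + measure_pmf.expectation M ?I"
    using finM by (simp add: integrable_measure_pmf_finite)
  also have "\<dots> < 1"
    using less W(1) p
    by (simp only: M_def expectation_card_clique_lists expectation_card_indep_sets)
      (simp add: c_def ac_simps)
  finally obtain D where D: "D \<in> set_pmf M" "c * ?T D + ?I D < 1"
    using exists_less_if_expectation_less[OF finM] by blast
  have "0 \<le> c * ?T D" by (simp add: c_def)
  then have "?I D = 0" and T: "c * ?T D < 1" using D(2) by auto
  then have "independence_number W D \<le> s"
    using fin by (intro independence_number_le_if_no_indep_Suc[OF W(1)]) auto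
  moreover have "fin_sgraph W D"
    using D(1) set_random_subset_pmf W(1) by (auto simp: M_def fin_sgraph_def)
  moreover have "?T D * s ^ (k - 1) < card W ^ k"
  proof -
    have "real (?T D * s ^ (k - 1)) < real (card W ^ k)"
      using T W by (simp add: c_def field_simps card_gt_0_iff)
    then show ?thesis unfolding of_nat_less_iff .
  qed
  ultimately show ?thesis by (auto simp: sparse_pattern_def)
qed

section \<open>The first moment bound for triangles\<close>

lemma list_weight_3:
  "list_weight m g 3 0 = m * g 1 + 3 * m * (m - 1) * g 2 + m * (m - 1) * (m - 2) * g 3"
  by (simp add: numeral_3_eq_3 numeral_2_eq_2 algebra_simps)

lemma sum_lessThan_eq_choose_2: "(\<Sum>i<n. i) = n choose 2"
  by (induction n) (simp_all add: numeral_2_eq_2)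

lemma exp_ge_Taylor_sum:
  fixes x :: real
  assumes "0 \<le> x \<or> even n"
  shows "(\<Sum>i<n. x ^ i / fact i) \<le> exp x"
proof -
  obtain t where "exp x = (\<Sum>i<n. x ^ i / fact i) + exp t / fact n * x ^ n"
    using Maclaurin_exp_le[of x n] by blast
  moreover have "0 \<le> exp t / fact n * x ^ n"
    using assms by (intro mult_nonneg_nonneg) (auto simp: zero_le_even_power)
  ultimately show ?thesis by linarith
qed

lemma binomial_times_fact_le:
  assumes "0 < m"
  shows "real (m choose s) * fact s \<le> real m ^ s * exp (- real (s choose 2) / real m)"
proof (cases "s \<le> m")
  case True
  have "real (m choose s) * fact s = (\<Prod>i<s. real m - real i)" by (rule binomial_times_fact)
  also have "\<dots> \<le> (\<Prod>i<s. real m * exp (- real i / real m))"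
  proof (rule prod_mono)
    fix i assume "i \<in> {..<s}"
    have "real m - real i = real m * (1 + - real i / real m)"
      using assms by (simp add: field_simps)
    also have "\<dots> \<le> real m * exp (- real i / real m)"
      by (intro mult_left_mono exp_ge_add_one_self) simp
    finally show "0 \<le> real m - real i \<and> real m - real i \<le> real m * exp (- real i / real m)"
      using \<open>i \<in> {..<s}\<close> True by simp
  qed
  also have "\<dots> = real m ^ s * exp (\<Sum>i<s. - real i / real m)"
    by (simp add: prod.distrib exp_sum)
  also have "(\<Sum>i<s. - real i / real m) = - real (s choose 2) / real m"
    by (simp flip: sum_divide_distrib sum_lessThan_eq_choose_2 add: sum_negf)
  finally show ?thesis .
qed (simp add: binomial_eq_0)

lemma binomial_times_power_choose_2_le:
  fixes p :: real
  assumes "0 < s" "0 < m" "p < 1"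
  shows "real (m choose s) * (1 - p) ^ (s choose 2)
    \<le> exp (s * (ln (m / s) + 1) - (s choose 2) * (1 / m - ln (1 - p)))"
proof -
  let ?c = "real (s choose 2)"
  have "real s ^ s / fact s \<le> (\<Sum>i<Suc s. real s ^ i / fact i)" by (simp add: sum_nonneg)
  also have "\<dots> \<le> exp s" by (rule exp_ge_Taylor_sum) simp
  finally have "real s ^ s / fact s \<le> exp s" .
  then have "real s ^ s * (real (m choose s) * fact s)
      \<le> (fact s * exp s) * (real m ^ s * exp (- ?c / m))"
    using assms by (intro mult_mono binomial_times_fact_le) (auto simp: field_simps)
  then have "real (m choose s) \<le> (m / s) ^ s * exp s * exp (- ?c / m)"
    using assms(1) by (simp add: field_simps)
  also have "(m / s) ^ s = exp (s * ln (m / s))"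
    using assms by (simp add: exp_of_nat_mult)
  finally have "real (m choose s) * (1 - p) ^ (s choose 2)
      \<le> (exp (s * ln (m / s)) * exp s * exp (- ?c / m)) * exp (?c * ln (1 - p))"
    using assms(3) by (simp add: exp_of_nat_mult mult_right_mono)
  also have "\<dots> = exp (s * (ln (m / s) + 1) - (s choose 2) * (1 / m - ln (1 - p)))"
    by (simp add: algebra_simps flip: exp_add)
  finally show ?thesis .
qed

lemma ln_79_le: "ln (79 :: real) \<le> 4.3697"
proof -
  have "1.31402 \<le> (\<Sum>i<5. (4.3697 / 16 :: real) ^ i / fact i)" by (simp add: eval_nat_numeral)
  also have "\<dots> \<le> exp (4.3697 / 16)" by (rule exp_ge_Taylor_sum) simp
  finally have "(1.31402 :: real) ^ 16 \<le> exp (4.3697 / 16) ^ 16" by (intro power_mono) auto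
  also have "\<dots> = exp 4.3697" by (simp flip: exp_of_nat_mult)
  finally have "79 \<le> exp (4.3697 :: real)" by (simp add: power_divide)
  from ln_mono[OF this] show ?thesis by simp
qed

lemma ln_one_minus_le: "ln (1 - 0.005165 :: real) \<le> - 0.005178"
proof -
  have "1 - 0.005165 \<le> (\<Sum>i<4. (- 0.005178 :: real) ^ i / fact i)" by (simp add: eval_nat_numeral)
  also have "\<dots> \<le> exp (- 0.005178)" by (rule exp_ge_Taylor_sum) simp
  finally have "1 - 0.005165 \<le> exp (- 0.005178 :: real)" .
  from ln_mono[OF this] show ?thesis by simp
qed

lemma exp_minus_7_le: "exp (- 7 :: real) \<le> 1 / 1000"
proof -
  have "2.7 \<le> (\<Sum>i<5. 1 ^ i / fact i :: real)" by (simp add: eval_nat_numeral)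
  also have "\<dots> \<le> exp 1" by (rule exp_ge_Taylor_sum) simp
  finally have "(2.7 :: real) ^ 7 \<le> exp 1 ^ 7" by (intro power_mono) auto
  also have "\<dots> = exp 7" by (simp flip: exp_of_nat_mult)
  finally have "1000 \<le> exp (7 :: real)" by (simp add: power_divide)
  then show ?thesis by (simp add: exp_minus field_simps)
qed

lemma exists_sparse_pattern_triangle: "\<exists>D. sparse_pattern 3 2073 {..<163846 :: nat} D"
proof (rule exists_sparse_pattern)
  let ?p = "0.005165 :: real"
  have "real (163846 choose 2074) * (1 - ?p) ^ (2074 choose 2)
      \<le> exp (real 2074 * (ln 79 + 1) - real (2074 choose 2) * (1 / 163846 - ln (1 - ?p)))"
    using binomial_times_power_choose_2_le[of 2074 163846 ?p] by simp
  also have "\<dots> \<le> exp (- 7)"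
    using ln_79_le ln_one_minus_le by (simp add: choose_two)
  also have "\<dots> \<le> 1 / 1000" by (rule exp_minus_7_le)
  finally have "real (163846 choose 2074) * (1 - ?p) ^ (2074 choose 2) \<le> 1 / 1000" .
  moreover have "list_weight 163846 (\<lambda>j. ?p ^ (j choose 2)) 3 0 * 2073 ^ 2 / 163846 ^ 3
      < 999 / 1000"
    by (simp add: list_weight_3 choose_two power3_eq_cube)
  ultimately show "list_weight (card {..<163846 :: nat}) (\<lambda>j. ?p ^ (j choose 2)) 3 0
      * real 2073 ^ (3 - 1) / real (card {..<163846 :: nat}) ^ 3
    + real (card {..<163846 :: nat} choose Suc 2073) * (1 - ?p) ^ (Suc 2073 choose 2) < 1"
    by simp
qed (auto simp: lessThan_empty_iff)

theorem theorem2p1: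
  fixes k l :: nat
  assumes "(k \<ge> 4 \<and> l \<ge> 3) \<or> (k = 3 \<and> l \<ge> 2074)"
  shows "\<exists>N. \<forall>n\<ge>N.
    (\<exists>(V :: nat set) E. fin_sgraph V E \<and> card V = n \<and> independence_number V E < l \<and>
       num_cliques k V E < num_cliques k {..<n} (co_turan_edges n (l - 1))) \<and>
    min_cliques n k l < num_cliques k {..<n} (co_turan_edges n (l - 1))"
proof -
  obtain s D and W :: "nat set" where "sparse_pattern k s W D" "1 \<le> s" "s \<le> l - 1"
  proof (cases "k = 3")
    case True
    then show ?thesis using assms exists_sparse_pattern_triangle that[of 2073] by auto
  next
    case False
    then show ?thesis using assms sparse_pattern_pentagon[of k] that[of 2] by auto
  qed
  then have "\<forall>\<^sub>F n in sequentially.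
      min_cliques n k l < num_cliques k {..<n} (co_turan_edges n (l - 1))"
    using eventually_min_cliques_less_if_sparse_pattern[of k s W D "l - 1"] assms by auto
  then obtain N where N: "\<And>n. N \<le> n \<Longrightarrow>
      min_cliques n k l < num_cliques k {..<n} (co_turan_edges n (l - 1))"
    by (auto simp: eventually_sequentially)
  moreover have "\<exists>V E. admissible n l V E \<and> num_cliques k V E = min_cliques n k l" for n
    using assms by (intro min_cliques_attained) auto
  ultimately show ?thesis
    unfolding admissible_def by metis
qed

end
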